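(* Let $n\ge 3f+1$ and let $V(r)$ be a delivered view with verdict groups $G_v$, candidate verdict $v^\star$, and a selected core $\widehat{C}\subseteq G_{v^\star}$. If $|\widehat{C}| > (n+f)/2$, then $\textit{verdict\_margin} > f$.
   Context: There are $n$ agents $\mathcal{N}=\{1,\dots,n\}$ and a fault bound $f\ge 0$ (integers). A delivered view $V(r)$ of a round $r$ consists of an index set $I_r\subseteq\mathcal{N}$ with $|I_r|\ge n-f$ (so $|V(r)|=|I_r|\le n$) together with, for each $i\in I_r$, a proposal carrying exactly one verdict in $\{\textsc{support},\textsc{refute},\textsc{insufficient}\}$. For a verdict $v$, $G_v\subseteq I_r$ is the set of delivered agents whose verdict is $v$; the $G_v$ partition the delivered view (some may be empty). The candidate verdict is $v^\star=\arg\max_v|G_v|$, with exact ties broken by the priority $\textsc{support}>\textsc{refute}>\textsc{insufficient}$. The margin is $\textit{verdict\_margin}=|G_{v^\star}|-\max_{v\ne v^\star}|G_v|$. The selected core $\widehat{C}$ is a subset of $G_{v^\star}$ selected by the protocol. *)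

theory Defs
  imports Complex_Main
begin

datatype verdict = Support | Refute | Insufficient

lemma UNIV_verdict: "(UNIV :: verdict set) = {Support, Refute, Insufficient}"
  using verdict.exhaust by auto

instance verdict :: finite
  by standard (simp add: UNIV_verdict)

text \<open>The type parameter is the remaining content of a proposal, which is left abstract.\<close>

datatype 'c proposal = Proposal (verdict_of: verdict) (content: 'c)

text \<open>A view maps each delivered agent to its proposal, so that its index set is
  \<^term>\<open>dom V\<close>.\<close>

type_synonym 'c view = "nat \<Rightarrow> 'c proposal option"

text \<open>The size bound is the subtraction-free form of \<open>card (dom V) \<ge> n - f\<close>, because
  subtraction on natural numbers truncates.\<close>

definition delivered_view :: "nat \<Rightarrow> nat \<Rightarrow> 'c view \<Rightarrow> bool" where
  "delivered_view n f V \<longleftrightarrow> dom V \<subseteq> {1..n} \<and> n \<le> card (dom V) + f"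

definition verdict_group :: "'c view \<Rightarrow> verdict \<Rightarrow> nat set" where
  "verdict_group V v = {i \<in> dom V. verdict_of (the (V i)) = v}"

fun priority :: "verdict \<Rightarrow> nat" where
  "priority Support = 2"
| "priority Refute = 1"
| "priority Insufficient = 0"

text \<open>Among the verdicts whose group is largest, take the one of highest priority.\<close>

definition candidate_verdict :: "'c view \<Rightarrow> verdict" where
  "candidate_verdict V =
     (ARG_MAX priority v. is_arg_max (\<lambda>w. card (verdict_group V w)) (\<lambda>_. True) v)"

text \<open>The margin is an integer, again to avoid truncated subtraction.\<close>

definition verdict_margin :: "'c view \<Rightarrow> int" where
  "verdict_margin V =
     int (card (verdict_group V (candidate_verdict V)))
     - int (Max ((\<lambda>v. card (verdict_group V v)) ` {v. v \<noteq> candidate_verdict V}))"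

lemma candidate_verdict_eq:
  fixes V :: "'c view"
  defines "g \<equiv> \<lambda>v. card (verdict_group V v)"
  shows "candidate_verdict V =
    (if g Refute \<le> g Support \<and> g Insufficient \<le> g Support then Support
     else if g Insufficient \<le> g Refute then Refute else Insufficient)"
proof -
  have all: "(\<forall>v. P v) \<longleftrightarrow> P Support \<and> P Refute \<and> P Insufficient" for P
    by (metis verdict.exhaust)
  have inj: "v = w" if "priority v = priority w" for v w
    using that by (cases v; cases w) simp_all
  let ?M = "is_arg_max g (\<lambda>_. True)"
  let ?c = "if g Refute \<le> g Support \<and> g Insufficient \<le> g Support then Support
     else if g Insufficient \<le> g Refute then Refute else Insufficient"
  have c: "is_arg_max priority ?M ?c"
    by (simp add: is_arg_max_def all not_less) linarith
  have uniq: "v = w" if "is_arg_max priority ?M v" "is_arg_max priority ?M w" for v w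
  proof (rule inj)
    have "\<not> priority v < priority w" "\<not> priority w < priority v"
      using that unfolding is_arg_max_def by blast+
    then show "priority v = priority w" by linarith
  qed
  have "is_arg_max priority ?M (arg_max priority ?M)"
    using c unfolding arg_max_def by (rule someI)
  then have "arg_max priority ?M = ?c"
    using c by (rule uniq)
  then show ?thesis
    by (simp add: candidate_verdict_def g_def)
qed

end

theory Submission
  imports Defs
begin

text \<open>Verdict groups are disjoint sets of agents, so if the candidate group has
  \<open>g\<close> members, every rival group has at most \<open>n - g\<close>. The margin is
  therefore at least \<open>2 * g - n\<close> (\<open>verdict_margin_ge\<close>). The core lies
  inside the candidate group, so \<open>2 * g\<close> exceeds \<open>n + f\<close>, which leaves a
  margin above \<open>f\<close>.\<close>

lemma card_verdict_group_add_le: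
  assumes "delivered_view n f V" and "v \<noteq> w"
  shows "card (verdict_group V v) + card (verdict_group V w) \<le> n"
proof -
  have sub: "verdict_group V u \<subseteq> {1..n}" for u
    using assms(1) by (auto simp: delivered_view_def verdict_group_def)
  then have fin: "finite (verdict_group V u)" for u
    by (rule finite_subset) simp
  have "verdict_group V v \<inter> verdict_group V w = {}"
    using assms(2) by (auto simp: verdict_group_def)
  then have "card (verdict_group V v) + card (verdict_group V w)
      = card (verdict_group V v \<union> verdict_group V w)"
    using fin by (simp add: card_Un_disjoint)
  also have "\<dots> \<le> card {1..n}"
    by (rule card_mono) (use sub in auto)
  finally show ?thesis by simp
qed

text \<open>Guarantees that the \<open>Max\<close> in the margin ranges over a nonempty set.\<close>

lemma ex_other_verdict: "\<exists>w :: verdict. w \<noteq> v"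
  by (cases v) blast+

text \<open>The strongest rival is an actual group, confined to the agents outside the candidate
  group. How the candidate is chosen does not enter the bound.\<close>

lemma verdict_margin_ge:
  assumes "delivered_view n f V"
  shows "verdict_margin V \<ge> 2 * int (card (verdict_group V (candidate_verdict V))) - int n"
proof -
  let ?c = "candidate_verdict V"
  let ?S = "(\<lambda>v. card (verdict_group V v)) ` {v. v \<noteq> ?c}"
  have "Max ?S \<in> ?S"
    using ex_other_verdict[of ?c] by (intro Max_in) auto
  then obtain w where "w \<noteq> ?c" and "Max ?S = card (verdict_group V w)" by blast
  then show ?thesis
    using card_verdict_group_add_le[OF assms, of ?c w] by (simp add: verdict_margin_def)
qed

theorem lemma5p3:
  fixes n f :: nat and V :: "'c view" and C :: "nat set"
  assumes "n \<ge> 3 * f + 1"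
    and "delivered_view n f V"
    and "C \<subseteq> verdict_group V (candidate_verdict V)"
    and "real (card C) > (real n + real f) / 2"
  shows "verdict_margin V > int f"
proof -
  have "finite (dom V)"
    using assms(2) by (auto simp: delivered_view_def intro: finite_subset)
  then have "finite (verdict_group V (candidate_verdict V))"
    by (simp add: verdict_group_def)
  then have "card C \<le> card (verdict_group V (candidate_verdict V))"
    using assms(3) by (rule card_mono)
  \<comment> \<open>Doubling clears the real division, so the strict threshold moves to the naturals
    without rounding.\<close>
  moreover have "n + f < 2 * card C"
    using assms(4) by (simp add: field_simps flip: of_nat_add)
  ultimately show ?thesis
    using verdict_margin_ge[OF assms(2)] by linarith
qed

end
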